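(* Let $\Omega$ be a fluid domain in $\nu$ dimensions carrying a continuum density $\rho$, velocity $\mathbf{u}$ and pressure $p$, and for each point $\mathbf{r}$ let $\Omega_h(\mathbf{r})$ be its test space, a locally compact space within $\Omega$ centred at $\mathbf{r}$. Let $w_h\in C_c^\infty(\Omega_h)$ be a convolution filter, let $\langle\rho_h\rangle,\widetilde{\mathbf{u}}_h,\langle p_h\rangle$ be the filtered fields obtained from $\rho,\mathbf{u},p$ by the filtering integral transform (FIT) with $w_h$, satisfying the filtered continuity equation $\frac{d}{dt}\langle\rho_h\rangle=-\langle\rho_h\rangle\nabla\cdot\widetilde{\mathbf{u}}_h$ with $\frac{d}{dt}=\frac{\partial}{\partial t}+\widetilde{\mathbf{u}}_h\cdot\nabla$, and let $\varphi_h\in C_c^\infty(\Omega_h)$ be a deconvolution filter associated with $w_h$, i.e. one for which the de-filtering integral transform (DIT) holds (both transforms are written out in the context). Then, because the de-filtered continuity equation $$\frac{d}{dt}\rho(\mathbf{r})=\int_{\Omega_h(\mathbf{r})}\langle\rho_h(\mathbf{r}')\rangle\big(\mathbf{u}(\mathbf{r})-\widetilde{\mathbf{u}}_h(\mathbf{r}')\big)\cdot\nabla\varphi_h(\mathbf{r}-\mathbf{r}')\,d^\nu\mathbf{r}'$$ and its point form $\frac{d}{dt}\rho(\mathbf{r})=-\rho(\mathbf{r})\nabla\cdot\mathbf{u}(\mathbf{r})$ are equivalent, the velocity divergence in the continuum can be calculated as an integral: $$\rho(\mathbf{r})\,\nabla\cdot\mathbf{u}(\mathbf{r})=-\int_{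\Omega_h(\mathbf{r})}\langle\rho_h(\mathbf{r}')\rangle\,\big(\mathbf{u}(\mathbf{r})-\widetilde{\mathbf{u}}_h(\mathbf{r}')\big)\cdot\nabla\varphi_h(\mathbf{r}-\mathbf{r}')\,d^\nu\mathbf{r}'.$$
   Context: FIT: $$\langle\rho_h(\mathbf{r})\rangle=\int_{\Omega_h(\mathbf{r})}\rho(\mathbf{r}')w_h(\mathbf{r}-\mathbf{r}')\,d^\nu\mathbf{r}',\quad \langle\rho_h(\mathbf{r})\rangle\widetilde{\mathbf{u}}_h(\mathbf{r})=\int_{\Omega_h(\mathbf{r})}\rho(\mathbf{r}')\mathbf{u}(\mathbf{r}')w_h(\mathbf{r}-\mathbf{r}')\,d^\nu\mathbf{r}',\quad \langle p_h(\mathbf{r})\rangle=\int_{\Omega_h(\mathbf{r})}p(\mathbf{r}')w_h(\mathbf{r}-\mathbf{r}')\,d^\nu\mathbf{r}'.$$ DIT: for each $w_h\in C_c^\infty(\Omega_h)$ it is posited that there exists $\varphi_h\in C_c^\infty(\Omega_h)$ such that $$\rho(\mathbf{r})=\int_{\Omega_h(\mathbf{r})}\langle\rho_h(\mathbf{r}')\rangle\varphi_h(\mathbf{r}-\mathbf{r}')\,d^\nu\mathbf{r}',\quad \rho(\mathbf{r})\mathbf{u}(\mathbf{r})=\int_{\Omega_h(\mathbf{r})}\langle\rho_h(\mathbf{r}')\rangle\widetilde{\mathbf{u}}_h(\mathbf{r}')\varphi_h(\mathbf{r}-\mathbf{r}')\,d^\nu\mathbf{r}',\quad p(\mathbf{r})=\int_{\Omega_h(\mathbf{r})}\langle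 p_h(\mathbf{r}')\rangle\varphi_h(\mathbf{r}-\mathbf{r}')\,d^\nu\mathbf{r}'.$$ $\nabla$ is the gradient with respect to $\mathbf{r}$. In $\frac{d}{dt}\rho(\mathbf{r})$ the derivative follows the target particle at $\mathbf{r}$, which moves with $\frac{d\mathbf{r}}{dt}=\mathbf{u}(\mathbf{r})$, while support particles at $\mathbf{r}'\in\Omega_h(\mathbf{r})$ move with $\frac{d\mathbf{r}'}{dt}=\widetilde{\mathbf{u}}_h(\mathbf{r}')$. Time dependence of the fields is suppressed. *)

theory Defs
  imports "HOL-Analysis.Analysis"
begin

definition grad :: "('v::euclidean_space \<Rightarrow> real) \<Rightarrow> 'v \<Rightarrow> 'v" where
  "grad f x = (\<Sum>b\<in>Basis. frechet_derivative f (at x) b *\<^sub>R b)"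

definition divergence :: "('v::euclidean_space \<Rightarrow> 'v) \<Rightarrow> 'v \<Rightarrow> real" where
  "divergence F x = (\<Sum>b\<in>Basis. frechet_derivative F (at x) b \<bullet> b)"

lemma GDERIV_grad:
  assumes "f differentiable at x"
  shows "GDERIV f x :> grad f x"
proof -
  have D: "(f has_derivative frechet_derivative f (at x)) (at x)"
    using assms frechet_derivative_works by blast
  then have lin: "linear (frechet_derivative f (at x))"
    by (rule has_derivative_linear)
  have "frechet_derivative f (at x) h = h \<bullet> grad f x" for h
  proof -
    have "frechet_derivative f (at x) h
        = frechet_derivative f (at x) (\<Sum>b\<in>Basis. (h \<bullet> b) *\<^sub>R b)"
      by (simp add: euclidean_representation)
    also have "\<dots> = (\<Sum>b\<in>Basis. (h \<bullet> b) * frechet_derivative f (at x) b)"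
      by (simp add: linear_sum[OF lin] linear_scale[OF lin])
    also have "\<dots> = h \<bullet> grad f x"
      by (simp add: grad_def inner_sum_right mult.commute)
    finally show ?thesis .
  qed
  then have "frechet_derivative f (at x) = (\<lambda>h. h \<bullet> grad f x)"
    by (rule ext)
  with D show ?thesis
    by (simp add: gderiv_def)
qed

text \<open>Fields depend on time and position. The material derivative
  \<open>d/dt = \<partial>/\<partial>t + v \<cdot> \<nabla>\<close> follows particles that move with the velocity
  field \<open>v\<close>; see \<open>material_deriv_along_trajectory\<close>.\<close>

definition material_deriv ::
    "(real \<Rightarrow> 'v::euclidean_space \<Rightarrow> 'v) \<Rightarrow> (real \<Rightarrow> 'v \<Rightarrow> real) \<Rightarrow> real \<Rightarrow> 'v \<Rightarrow> real" where
  "material_deriv v f t r = deriv (\<lambda>s. f s r) t + v t r \<bullet> grad (f t) r"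

lemma material_deriv_along_trajectory:
  fixes f :: "real \<Rightarrow> 'v::euclidean_space \<Rightarrow> real"
  assumes f: "(\<lambda>(s, x). f s x) differentiable at (t, X t)"
    and X: "(X has_vector_derivative v t (X t)) (at t)"
  shows "((\<lambda>s. f s (X s)) has_real_derivative material_deriv v f t (X t)) (at t)"
proof -
  let ?f = "\<lambda>(s, x). f s x"
  obtain L where L: "(?f has_derivative L) (at (t, X t))"
    using f unfolding differentiable_def by blast
  have lin: "linear L"
    using L by (rule has_derivative_linear)
  have time: "((\<lambda>s. ?f (s, X t)) has_derivative (\<lambda>h. L (h, 0))) (at t)"
    by (rule has_derivative_compose[of "\<lambda>s. (s, X t)" _ t UNIV ?f L, simplified o_def])
       (auto intro!: derivative_eq_intros L)
  have space: "((\<lambda>x. ?f (t, x)) has_derivative (\<lambda>h. L (0, h))) (at (X t))"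
    by (rule has_derivative_compose[of "\<lambda>x. (t, x)" _ "X t" UNIV ?f L, simplified o_def])
       (auto intro!: derivative_eq_intros L)
  have XD: "(X has_derivative (\<lambda>h. h *\<^sub>R v t (X t))) (at t)"
    using X by (simp add: has_vector_derivative_def)
  have traj: "((\<lambda>s. ?f (s, X s)) has_derivative (\<lambda>h. L (h, h *\<^sub>R v t (X t)))) (at t)"
    by (rule has_derivative_compose[of "\<lambda>s. (s, X s)" _ t UNIV ?f L, simplified o_def])
       (auto intro!: derivative_eq_intros L XD)
  have split: "L (h, k) = L (h, 0) + L (0, k)" for h k
    using linear_add[OF lin, of "(h, 0)" "(0, k)"] by simp
  have scale1: "L (h, 0) = h * L (1, 0)" for h
    using linear_scale[OF lin, of h "(1, 0)"] by simp
  have scale2: "L (0, h *\<^sub>R k) = h * L (0, k)" for h k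
    using linear_scale[OF lin, of h "(0, k)"] by simp
  have Ltime: "(\<lambda>h. L (h, 0)) = (*) (L (1, 0))"
    by (rule ext, subst scale1, rule mult.commute)
  have "((\<lambda>s. f s (X t)) has_real_derivative L (1, 0)) (at t)"
    using time unfolding has_field_derivative_def Ltime[symmetric] by simp
  then have d1: "deriv (\<lambda>s. f s (X t)) t = L (1, 0)"
    by (rule DERIV_imp_deriv)
  have "GDERIV (f t) (X t) :> grad (f t) (X t)"
    using space by (intro GDERIV_grad) (auto simp: differentiable_def)
  then have "(\<lambda>h. h \<bullet> grad (f t) (X t)) = (\<lambda>h. L (0, h))"
    using space unfolding gderiv_def by (auto intro: has_derivative_unique)
  then have d2: "v t (X t) \<bullet> grad (f t) (X t) = L (0, v t (X t))"
    by (rule fun_cong)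
  have "L (h, h *\<^sub>R v t (X t)) = material_deriv v f t (X t) * h" for h
    unfolding material_deriv_def d1 d2
    by (subst split, subst scale1, subst scale2) (simp add: algebra_simps)
  then show ?thesis
    using traj by (simp add: has_field_derivative_def)
qed

primrec Ck :: "nat \<Rightarrow> ('v::euclidean_space \<Rightarrow> real) \<Rightarrow> bool" where
  "Ck 0 f \<longleftrightarrow> continuous_on UNIV f"
| "Ck (Suc k) f \<longleftrightarrow> (\<forall>x. f differentiable at x) \<and>
     (\<forall>v. Ck k (\<lambda>x. frechet_derivative f (at x) v))"

text \<open>\<open>C\<^sub>c\<^sup>\<infinity>(S)\<close>, each function extended by zero to the whole space.\<close>

definition Cc_infty :: "'v::euclidean_space set \<Rightarrow> ('v \<Rightarrow> real) set" where
  "Cc_infty S = {f. (\<forall>k. Ck k f) \<and> compact (closure {x. f x \<noteq> 0}) \<and>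
                    closure {x. f x \<noteq> 0} \<subseteq> S}"

text \<open>A filter is a function of the displacement \<open>r - r'\<close>. It belongs to \<open>C\<^sub>c\<^sup>\<infinity>(\<Omega>h)\<close> over
  the region \<open>D\<close> when, for each \<open>r \<in> D\<close>, the weight \<open>r' \<mapsto> w (r - r')\<close> is a test function on
  the test space \<open>\<Omega>h r\<close> of \<open>r\<close>.\<close>

definition filter_on :: "'v::euclidean_space set \<Rightarrow> ('v \<Rightarrow> 'v set) \<Rightarrow> ('v \<Rightarrow> real) \<Rightarrow> bool" where
  "filter_on D \<Omega>h w \<longleftrightarrow> (\<forall>r\<in>D. (\<lambda>r'. w (r - r')) \<in> Cc_infty (\<Omega>h r))"

text \<open>In both transforms \<open>T\<close> is the set of times and \<open>D\<close> the set of target points \<open>r\<close>.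
  A filter supported in the test space of every point of a bounded nonempty domain vanishes, so
  \<open>D\<close> may be smaller than the fluid domain and may differ for the two transforms; \<open>D\<close> equal to
  the whole domain is allowed.\<close>

definition FIT where
  "FIT T D \<Omega>h w \<rho> u p \<rho>h uh ph \<longleftrightarrow>
     (\<forall>t\<in>T. \<forall>r\<in>D.
        \<rho>h t r = (LINT r':\<Omega>h r|lborel. \<rho> t r' * w (r - r')) \<and>
        \<rho>h t r *\<^sub>R uh t r = (LINT r':\<Omega>h r|lborel. (\<rho> t r' * w (r - r')) *\<^sub>R u t r') \<and>
        ph t r = (LINT r':\<Omega>h r|lborel. p t r' * w (r - r')))"
  for \<Omega>h :: "'v::euclidean_space \<Rightarrow> 'v set"
    and \<rho> p \<rho>h ph :: "real \<Rightarrow> 'v \<Rightarrow> real"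
    and u uh :: "real \<Rightarrow> 'v \<Rightarrow> 'v"

definition DIT where
  "DIT T D \<Omega>h \<phi> \<rho> u p \<rho>h uh ph \<longleftrightarrow>
     (\<forall>t\<in>T. \<forall>r\<in>D.
        \<rho> t r = (LINT r':\<Omega>h r|lborel. \<rho>h t r' * \<phi> (r - r')) \<and>
        \<rho> t r *\<^sub>R u t r = (LINT r':\<Omega>h r|lborel. (\<rho>h t r' * \<phi> (r - r')) *\<^sub>R uh t r') \<and>
        p t r = (LINT r':\<Omega>h r|lborel. ph t r' * \<phi> (r - r')))"
  for \<Omega>h :: "'v::euclidean_space \<Rightarrow> 'v set"
    and \<rho> p \<rho>h ph :: "real \<Rightarrow> 'v \<Rightarrow> real"
    and u uh :: "real \<Rightarrow> 'v \<Rightarrow> 'v"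

end

theory Submission
  imports Defs
begin

text \<open>Only the de-filtering transform matters. Differentiating it under the integral sign
  gives \<open>\<nabla>\<rho> = \<integral> \<langle>\<rho>h\<rangle> \<nabla>\<phi>\<close> and \<open>\<nabla> \<cdot> (\<rho> u) = \<integral> \<langle>\<rho>h\<rangle> uh \<cdot> \<nabla>\<phi>\<close>, and the product rule
  \<open>\<rho> \<nabla> \<cdot> u = \<nabla> \<cdot> (\<rho> u) - u \<cdot> \<nabla>\<rho>\<close> yields the divergence formula as a kinematic identity, with
  no recourse to the time derivative. The two forms of the continuity equation then have equal
  right-hand sides. The filtered fields are known near the test spaces only, so they are extended
  continuously off a compact neighbourhood of the support of the filter.\<close>

section \<open>Integrals and derivatives of functions with a prescribed support\<close>

text \<open>Removes the domain of integration, which moves with the target point: over the whole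
  space, the target point enters an integral only through its kernel.\<close>

lemma set_lebesgue_integral_eq_support:
  assumes "\<And>x. x \<notin> A \<Longrightarrow> f x = 0"
  shows "set_lebesgue_integral M A f = integral\<^sup>L M f"
    and "set_integrable M A f \<longleftrightarrow> integrable M f"
proof -
  have *: "(\<lambda>x. indicator A x *\<^sub>R f x) = f"
    using assms by (auto simp: indicator_def fun_eq_iff)
  show "set_lebesgue_integral M A f = integral\<^sup>L M f" "set_integrable M A f \<longleftrightarrow> integrable M f"
    by (simp_all add: set_lebesgue_integral_def set_integrable_def *)
qed

text \<open>A bridge from the Lebesgue integral of the transforms to the gauge integral over a
  compact set, for which the Leibniz rule is formulated.\<close>

lemma integrable_compact_support:
  fixes f :: "'a::euclidean_space \<Rightarrow> 'b::euclidean_space"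
  assumes "compact C" "continuous_on C f" "\<And>x. x \<notin> C \<Longrightarrow> f x = 0"
  shows "integrable lborel f" "integral\<^sup>L lborel f = integral C f" "f integrable_on C"
proof -
  have s: "set_integrable lborel C f"
    using borel_integrable_compact[OF assms(1,2)] by (simp add: set_integrable_def)
  with assms(3) show "integrable lborel f"
    by (simp add: set_lebesgue_integral_eq_support)
  show "f integrable_on C" "integral\<^sup>L lborel f = integral C f"
    using set_borel_integral_eq_integral[OF s] assms(3)
    by (simp_all add: set_lebesgue_integral_eq_support)
qed

text \<open>As \<open>K\<close> is closed, \<open>f\<close> vanishes on a whole neighbourhood of
  \<open>z\<close>. The same \<open>K\<close> can therefore serve a filter and its
  derivatives.\<close>

lemma frechet_derivative_eq_0_outside_support:
  assumes "closed K" "\<And>z. z \<notin> K \<Longrightarrow> f z = 0" "z \<notin> K"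
  shows "frechet_derivative f (at z) = (\<lambda>_. 0)"
proof -
  have "(f has_derivative (\<lambda>_. 0)) (at z)"
    by (rule has_derivative_transform_within_open[of "\<lambda>_. 0" _ _ _ "- K"])
       (use assms in auto)
  then show ?thesis
    by (metis frechet_derivative_at)
qed

lemma has_real_derivative_along_line:
  fixes f :: "'v::real_normed_vector \<Rightarrow> real"
  assumes "f differentiable at (x + s *\<^sub>R b)"
  shows "((\<lambda>s. f (x + s *\<^sub>R b)) has_real_derivative frechet_derivative f (at (x + s *\<^sub>R b)) b)
           (at s within S)"
proof -
  let ?D = "frechet_derivative f (at (x + s *\<^sub>R b))"
  have D: "(f has_derivative ?D) (at (x + s *\<^sub>R b))"
    using assms frechet_derivative_works by blast
  have "((\<lambda>s. f (x + s *\<^sub>R b)) has_derivative (\<lambda>h. ?D (h *\<^sub>R b))) (at s within S)"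
    by (rule has_derivative_compose[where g = f and f = "\<lambda>s. x + s *\<^sub>R b", OF _ D])
       (auto intro!: derivative_eq_intros)
  moreover have "?D (h *\<^sub>R b) = ?D b * h" for h
    using linear_scale[OF has_derivative_linear[OF D], of h b] by simp
  ultimately show ?thesis
    by (simp add: has_field_derivative_def mult_commute_abs)
qed

section \<open>Differentiating a convolution in the direction \<open>b\<close>\<close>

text \<open>For \<open>s\<close> between -1 and 1 all integrands vanish off one fixed box, so the
  Leibniz rule on a compact box applies.\<close>

lemma convolution_has_real_derivative_UNIV:
  fixes g \<phi> :: "'v::euclidean_space \<Rightarrow> real"
  assumes g: "continuous_on UNIV g"
    and K: "compact K" "\<And>z. z \<notin> K \<Longrightarrow> \<phi> z = 0"
    and \<phi>: "\<And>z. \<phi> differentiable at z" "continuous_on UNIV (\<lambda>z. frechet_derivative \<phi> (at z) b)"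
  shows "((\<lambda>s. LINT y|lborel. g y * \<phi> (x + s *\<^sub>R b - y)) has_real_derivative
          (LINT y|lborel. g y * frechet_derivative \<phi> (at (x - y)) b)) (at 0)"
proof -
  let ?U = "{-1<..<1::real}"
  let ?d = "\<lambda>z. frechet_derivative \<phi> (at z) b"
  \<comment> \<open>This image collects every \<open>y\<close> that the shifted kernel can reach;
    the closed parameter interval makes it compact, hence enclosed in a box.\<close>
  have "compact ((\<lambda>(s, z). x + s *\<^sub>R b - z) ` ({-1..1} \<times> K))"
    unfolding split_beta
    by (intro compact_continuous_image compact_Times K continuous_intros) auto
  then obtain a where a: "(\<lambda>(s, z). x + s *\<^sub>R b - z) ` ({-1..1} \<times> K) \<subseteq> cbox (-a) a"
    by (meson bounded_subset_cbox_symmetric compact_imp_bounded)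
  have out: "x + s *\<^sub>R b - y \<notin> K" if "s \<in> ?U" "y \<notin> cbox (-a) a" for s y
  proof
    assume "x + s *\<^sub>R b - y \<in> K"
    then have "x + s *\<^sub>R b - (x + s *\<^sub>R b - y) \<in> cbox (-a) a"
      using that(1) by (intro subsetD[OF a]) (force intro!: image_eqI[of _ _ "(s, x + s *\<^sub>R b - y)"])
    then show False
      using that(2) by simp
  qed
  have d0: "?d z = 0" if "z \<notin> K" for z
    using frechet_derivative_eq_0_outside_support[of K \<phi> z] K that by (simp add: compact_imp_closed)
  have c\<phi>: "continuous_on UNIV \<phi>"
    by (simp add: \<phi>(1) differentiable_imp_continuous_within continuous_at_imp_continuous_on)
  \<comment> \<open>Stated for an arbitrary kernel \<open>h\<close>, since it is applied both to
    \<open>\<phi>\<close> and to its directional derivative.\<close>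
  have eq: "(LINT y|lborel. g y * h (x + s *\<^sub>R b - y)) = integral (cbox (-a) a) (\<lambda>y. g y * h (x + s *\<^sub>R b - y))"
    "(\<lambda>y. g y * h (x + s *\<^sub>R b - y)) integrable_on cbox (-a) a"
    if "s \<in> ?U" "continuous_on UNIV h" "\<And>z. z \<notin> K \<Longrightarrow> h z = 0" for s and h :: "'v \<Rightarrow> real"
    using out[OF that(1)] that(3)
    by (auto intro!: integrable_compact_support continuous_intros continuous_on_compose2[OF that(2)]
        continuous_on_subset[OF g])
  have "((\<lambda>s. integral (cbox (-a) a) (\<lambda>y. g y * \<phi> (x + s *\<^sub>R b - y))) has_real_derivative
      integral (cbox (-a) a) (\<lambda>y. g y * ?d (x + 0 *\<^sub>R b - y))) (at 0 within ?U)"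
  proof (rule leibniz_rule_field_derivative)
    show "((\<lambda>s. g y * \<phi> (x + s *\<^sub>R b - y)) has_real_derivative g y * ?d (x + s *\<^sub>R b - y)) (at s within ?U)"
      for s y
      using has_real_derivative_along_line[of \<phi> "x - y" s b ?U] \<phi>(1)
      by (auto intro!: derivative_eq_intros simp: algebra_simps)
    show "continuous_on (?U \<times> cbox (-a) a) (\<lambda>(s, y). g y * ?d (x + s *\<^sub>R b - y))"
      unfolding split_beta
      by (intro continuous_intros continuous_on_compose2[OF g] continuous_on_compose2[OF \<phi>(2)]) auto
  qed (use eq(2)[OF _ c\<phi> K(2)] in auto)
  then have "((\<lambda>s. integral (cbox (-a) a) (\<lambda>y. g y * \<phi> (x + s *\<^sub>R b - y))) has_real_derivative
      (LINT y|lborel. g y * ?d (x - y))) (at 0)"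
    using eq(1)[of 0, OF _ \<phi>(2) d0] by (simp add: at_within_open[of 0 ?U])
  then show ?thesis
    by (rule has_field_derivative_transform_within_open[of _ _ _ ?U])
       (use eq(1)[OF _ c\<phi> K(2)] in auto)
qed

text \<open>For small \<open>s\<close> the integral reads \<open>g\<close> only on a compact subset
  of \<open>W\<close>. There \<open>g\<close> agrees with a Tietze extension, to which the global
  version applies.\<close>

lemma convolution_has_real_derivative:
  fixes g \<phi> :: "'v::euclidean_space \<Rightarrow> real"
  assumes g: "continuous_on W g" "open W" "(\<lambda>z. x - z) ` K \<subseteq> W"
    and K: "compact K" "\<And>z. z \<notin> K \<Longrightarrow> \<phi> z = 0"
    and \<phi>: "\<And>z. \<phi> differentiable at z" "continuous_on UNIV (\<lambda>z. frechet_derivative \<phi> (at z) b)"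
  shows "((\<lambda>s. LINT y|lborel. g y * \<phi> (x + s *\<^sub>R b - y)) has_real_derivative
          (LINT y|lborel. g y * frechet_derivative \<phi> (at (x - y)) b)) (at 0)"
proof -
  have "compact ((\<lambda>z. x - z) ` K)"
    by (intro compact_continuous_image K continuous_intros)
  then obtain e where e: "e > 0" "(\<Union>y\<in>(\<lambda>z. x - z) ` K. ball y e) \<subseteq> W"
    using compact_subset_open_imp_ball_epsilon_subset g by metis
  \<comment> \<open>Chosen so that the displacement \<open>s *\<^sub>R b\<close> stays shorter than
    \<open>e\<close> when \<bar>s\<bar> \<le> \<delta>; the added 1 keeps the denominator positive
    even for \<open>b = 0\<close>.\<close>
  define \<delta> where "\<delta> = e / (norm b + 1)"
  have \<delta>: "\<delta> > 0"
    using e by (simp add: \<delta>_def add_nonneg_pos)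
  have \<delta>b: "\<delta> * norm b < e"
    using e by (simp add: \<delta>_def pos_divide_less_eq add_nonneg_pos distrib_left)
  define C where "C = (\<lambda>(s, z). x + s *\<^sub>R b - z) ` ({-\<delta>..\<delta>} \<times> K)"
  have "compact C"
    unfolding C_def split_beta
    by (intro compact_continuous_image compact_Times K continuous_intros) auto
  have "C \<subseteq> W"
  proof
    fix y assume "y \<in> C"
    then obtain s z where sz: "\<bar>s\<bar> \<le> \<delta>" "z \<in> K" "y = x + s *\<^sub>R b - z"
      unfolding C_def by (force simp: abs_le_iff)
    have "\<bar>s\<bar> * norm b < e"
      using mult_right_mono[OF sz(1), of "norm b"] \<delta>b by simp
    then have "y \<in> ball (x - z) e"
      by (simp add: sz dist_norm)
    then show "y \<in> W"
      using e(2) sz(2) by blast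
  qed
  then have "continuous_on C g"
    using g continuous_on_subset by blast
  then obtain g' where g': "continuous_on UNIV g'" "\<And>y. y \<in> C \<Longrightarrow> g' y = g y"
    using Tietze_unbounded[of C g UNIV] \<open>compact C\<close> by (auto simp: compact_imp_closed)
  have inC: "y \<in> C" if "\<bar>s\<bar> < \<delta>" "x + s *\<^sub>R b - y \<in> K" for s y
    unfolding C_def using that by (force intro!: image_eqI[of _ _ "(s, x + s *\<^sub>R b - y)"])
  \<comment> \<open>On \<open>C\<close> the two functions agree, and off \<open>C\<close> the kernel
    is zero, so the integrands coincide everywhere.\<close>
  have same: "(LINT y|lborel. g' y * h (x + s *\<^sub>R b - y)) = (LINT y|lborel. g y * h (x + s *\<^sub>R b - y))"
    if "\<bar>s\<bar> < \<delta>" "\<And>z. z \<notin> K \<Longrightarrow> h z = 0" for s and h :: "'v \<Rightarrow> real"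
  proof -
    have "g' y * h (x + s *\<^sub>R b - y) = g y * h (x + s *\<^sub>R b - y)" for y
      using inC[OF that(1), of y] that(2) g'(2) by fastforce
    then show ?thesis
      by (simp only:)
  qed
  have d0: "frechet_derivative \<phi> (at z) b = 0" if "z \<notin> K" for z
    using frechet_derivative_eq_0_outside_support[of K \<phi> z] K that by (simp add: compact_imp_closed)
  have "((\<lambda>s. LINT y|lborel. g' y * \<phi> (x + s *\<^sub>R b - y)) has_real_derivative
          (LINT y|lborel. g y * frechet_derivative \<phi> (at (x - y)) b)) (at 0)"
    using convolution_has_real_derivative_UNIV[OF g'(1) K \<phi>, of x]
      same[of 0 "\<lambda>z. frechet_derivative \<phi> (at z) b", OF _ d0] \<delta> by simp
  then show ?thesis
    by (rule has_field_derivative_transform_within_open[of _ _ _ "{-\<delta><..<\<delta>}"])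
       (use same[of _ \<phi>, OF _ K(2)] \<delta> in \<open>auto simp: abs_less_iff\<close>)
qed

section \<open>Regularity and support of filters in the displacement variable\<close>

lemma filter_onD:
  assumes "filter_on D \<Omega>h w" "r \<in> D" "y \<notin> \<Omega>h r"
  shows "w (r - y) = 0"
proof (rule ccontr)
  assume "w (r - y) \<noteq> 0"
  then have "y \<in> closure {y. w (r - y) \<noteq> 0}"
    by (intro subsetD[OF closure_subset]) simp
  then show False
    using assms unfolding filter_on_def Cc_infty_def by blast
qed

text \<open>A single target point controls \<open>w\<close> on the whole space: \<open>w\<close> is
  the test function \<open>\<lambda>y. w (r - y)\<close> composed with the affine bijection
  \<open>\<lambda>z. r - z\<close>, and the chain rule transfers its regularity.\<close>

lemma filter_on_smooth:
  assumes "filter_on D \<Omega>h w" "r \<in> D"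
  shows "w differentiable at z" "continuous_on UNIV (\<lambda>z. frechet_derivative w (at z) v)"
proof -
  define f where "f = (\<lambda>y. w (r - y))"
  have "Ck (Suc 0) f"
    using assms unfolding filter_on_def Cc_infty_def f_def by blast
  then have f: "f differentiable at y" "continuous_on UNIV (\<lambda>y. frechet_derivative f (at y) v)" for y v
    by simp_all
  have D: "(w has_derivative (\<lambda>h. frechet_derivative f (at (r - z)) (- h))) (at z)" for z
  proof -
    have "(f has_derivative frechet_derivative f (at (r - z))) (at (r - z))"
      using f frechet_derivative_works by blast
    then have "((\<lambda>z. f (r - z)) has_derivative (\<lambda>h. frechet_derivative f (at (r - z)) (- h))) (at z)"
      by (rule has_derivative_compose[where g = f and f = "\<lambda>z. r - z", rotated])
         (auto intro!: derivative_eq_intros)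
    then show ?thesis
      by (simp add: f_def)
  qed
  show "w differentiable at z"
    using D differentiable_def by blast
  have "(\<lambda>z. frechet_derivative w (at z) v) = (\<lambda>z. frechet_derivative f (at (r - z)) (- v))"
    by (simp only: frechet_derivative_at[OF D, symmetric])
  then show "continuous_on UNIV (\<lambda>z. frechet_derivative w (at z) v)"
    by (simp only:)
       (rule continuous_on_compose2[where f = "\<lambda>z. r - z", OF f(2)]; simp add: continuous_intros)
qed

text \<open>Translates support in the position \<open>r'\<close> into support in the displacement:
  \<open>K\<close> is the mirror image of the closed support under \<open>\<lambda>z. r - z\<close>,
  which is its own inverse.\<close>

lemma filter_on_support:
  assumes "filter_on D \<Omega>h w" "r \<in> D"
  obtains K where "compact K" "\<And>z. z \<notin> K \<Longrightarrow> w z = 0" "(\<lambda>z. r - z) ` K \<subseteq> \<Omega>h r"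
proof
  let ?C = "closure {y. w (r - y) \<noteq> 0}"
  have C: "compact ?C" "?C \<subseteq> \<Omega>h r"
    using assms unfolding filter_on_def Cc_infty_def by blast+
  show "compact ((\<lambda>z. r - z) ` ?C)"
    by (intro compact_continuous_image C continuous_intros)
  show "w z = 0" if "z \<notin> (\<lambda>z. r - z) ` ?C" for z
  proof (rule ccontr)
    assume "w z \<noteq> 0"
    then have "r - z \<in> ?C"
      by (intro subsetD[OF closure_subset]) simp
    then show False
      using that imageI[of "r - z" ?C "\<lambda>z. r - z"] by simp
  qed
  show "(\<lambda>z. r - z) ` (\<lambda>z. r - z) ` ?C \<subseteq> \<Omega>h r"
    using C(2) by (auto simp: image_image)
qed

section \<open>The divergence identity at a fixed time\<close>

text \<open>The time variable is frozen, and \<open>m\<close> is a filtered density.\<close>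

lemma defiltered_divergence:
  fixes W D :: "'v::euclidean_space set"
  assumes D: "open D" "r \<in> D"
    and W: "open W" "continuous_on W m" "continuous_on W v" "\<And>x. x \<in> D \<Longrightarrow> \<Omega>h x \<subseteq> W"
    and \<phi>: "filter_on D \<Omega>h \<phi>"
    and \<rho>: "\<And>x. x \<in> D \<Longrightarrow> \<rho> x = (LINT y:\<Omega>h x|lborel. m y * \<phi> (x - y))"
    and \<rho>u: "\<And>x. x \<in> D \<Longrightarrow> \<rho> x *\<^sub>R u x = (LINT y:\<Omega>h x|lborel. (m y * \<phi> (x - y)) *\<^sub>R v y)"
    and u: "u differentiable at r"
  shows "set_integrable lborel (\<Omega>h r) (\<lambda>y. m y * ((u r - v y) \<bullet> grad (\<lambda>x. \<phi> (x - y)) r))"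
    and "\<rho> r * divergence u r
      = - (LINT y:\<Omega>h r|lborel. m y * ((u r - v y) \<bullet> grad (\<lambda>x. \<phi> (x - y)) r))"
proof -
  note smooth = filter_on_smooth[OF \<phi> D(2)]
  define d where "d b z = frechet_derivative \<phi> (at z) b" for b z
  \<comment> \<open>\<open>I b\<close> will turn out to be the derivative of \<open>\<rho>\<close>
    at \<open>r\<close> along \<open>b\<close>, and \<open>J b\<close>, for a basis vector
    \<open>b\<close>, that of the component of \<open>\<rho> u\<close> along
    \<open>b\<close>.\<close>
  define I J where "I b = (LINT y|lborel. m y * d b (r - y))"
    and "J b = (LINT y|lborel. (m y * (v y \<bullet> b)) * d b (r - y))" for b
  have supp: "\<exists>K. compact K \<and> (\<forall>z. z \<notin> K \<longrightarrow> \<phi> z = 0 \<and> d b z = 0) \<and> (\<lambda>z. x - z) ` K \<subseteq> \<Omega>h x"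
    if x: "x \<in> D" for x b
  proof -
    obtain K where K: "compact K" "\<And>z. z \<notin> K \<Longrightarrow> \<phi> z = 0" "(\<lambda>z. x - z) ` K \<subseteq> \<Omega>h x"
      using filter_on_support[OF \<phi> x] by metis
    moreover have "d b z = 0" if "z \<notin> K" for z
      using frechet_derivative_eq_0_outside_support[of K \<phi> z] K that
      by (simp add: d_def compact_imp_closed)
    ultimately show ?thesis
      by blast
  qed
  have d_out: "d b (r - y) = 0" if "y \<notin> \<Omega>h r" for b y
  proof -
    obtain K where K: "\<forall>z. z \<notin> K \<longrightarrow> d b z = 0" "(\<lambda>z. r - z) ` K \<subseteq> \<Omega>h r"
      using supp[OF D(2), of b] by blast
    have "r - y \<notin> K"
      using K(2) that imageI[of "r - y" K "\<lambda>z. r - z"] by auto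
    then show ?thesis
      using K by blast
  qed
  \<comment> \<open>The integrand lives on the mirrored support, a compact subset of
    \<open>\<Omega>h x\<close> and hence of \<open>W\<close>, where \<open>g\<close> is
    continuous.\<close>
  have int: "integrable lborel (\<lambda>y. g y * h (x - y))"
    if x: "x \<in> D" and g: "continuous_on W g" and h: "continuous_on UNIV h" "h = \<phi> \<or> h = d b" for x b g h
  proof -
    obtain K where K: "compact K" "\<forall>z. z \<notin> K \<longrightarrow> h z = 0" "(\<lambda>z. x - z) ` K \<subseteq> \<Omega>h x"
      using supp[OF x, of b] h(2) by blast
    show ?thesis
    proof (rule integrable_compact_support)
      show "compact ((\<lambda>z. x - z) ` K)"
        by (intro compact_continuous_image K continuous_intros)
      show "continuous_on ((\<lambda>z. x - z) ` K) (\<lambda>y. g y * h (x - y))"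
        using K(3) W(4)[OF x]
        by (intro continuous_intros continuous_on_compose2[OF h(1)] continuous_on_subset[OF g]) auto
      show "g y * h (x - y) = 0" if "y \<notin> (\<lambda>z. x - z) ` K" for y
        using K(2) that imageI[of "x - y" K "\<lambda>z. x - z"] by auto
    qed
  qed
  have c\<phi>: "continuous_on UNIV \<phi>"
    by (simp add: smooth(1) differentiable_imp_continuous_within continuous_at_imp_continuous_on)
  have cd: "continuous_on UNIV (d b)" for b
    using smooth(2) by (simp add: d_def)
  have \<rho>': "\<rho> x = (LINT y|lborel. m y * \<phi> (x - y))" if "x \<in> D" for x
    using filter_onD[OF \<phi> that] \<rho>[OF that] by (simp add: set_lebesgue_integral_eq_support)
  have \<rho>u': "\<rho> x * (u x \<bullet> b) = (LINT y|lborel. (m y * (v y \<bullet> b)) * \<phi> (x - y))"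
    if "x \<in> D" for x b
  proof -
    \<comment> \<open>Integrability of the vector-valued integrand permits moving the inner product
      with \<open>b\<close> inside the integral; it follows from that of the components.\<close>
    have i: "integrable lborel (\<lambda>y. (m y * \<phi> (x - y)) *\<^sub>R v y)"
    proof -
      have "integrable lborel (\<lambda>y. \<Sum>c\<in>Basis. ((m y * (v y \<bullet> c)) * \<phi> (x - y)) *\<^sub>R c)"
        by (intro Bochner_Integration.integrable_sum integrable_scaleR_left int that c\<phi> disjI1 refl
            continuous_intros W)
      moreover have "(\<Sum>c\<in>Basis. ((m y * (v y \<bullet> c)) * \<phi> (x - y)) *\<^sub>R c)
          = (m y * \<phi> (x - y)) *\<^sub>R v y" for y
        by (subst (2) euclidean_representation[symmetric])
           (simp add: scaleR_sum_right mult_ac del: euclidean_representation)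
      ultimately show ?thesis
        by simp
    qed
    have "\<rho> x *\<^sub>R u x = (LINT y|lborel. (m y * \<phi> (x - y)) *\<^sub>R v y)"
      using filter_onD[OF \<phi> that] \<rho>u[OF that] by (simp add: set_lebesgue_integral_eq_support)
    then have "\<rho> x * (u x \<bullet> b) = (LINT y|lborel. (m y * \<phi> (x - y)) *\<^sub>R v y) \<bullet> b"
      by (metis inner_scaleR_left)
    also have "\<dots> = (LINT y|lborel. ((m y * \<phi> (x - y)) *\<^sub>R v y) \<bullet> b)"
      using i by (intro integral_inner_left[symmetric]) simp
    finally show ?thesis
      by (simp add: mult_ac)
  qed
  have deriv: "((\<lambda>s. LINT y|lborel. g y * \<phi> (r + s *\<^sub>R b - y)) has_real_derivative
      (LINT y|lborel. g y * d b (r - y))) (at 0)" if g: "continuous_on W g" for g b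
  proof -
    obtain K where K: "compact K" "\<And>z. z \<notin> K \<Longrightarrow> \<phi> z = 0" "(\<lambda>z. r - z) ` K \<subseteq> \<Omega>h r"
      using filter_on_support[OF \<phi> D(2)] by metis
    then show ?thesis
      unfolding d_def using W(4)[OF D(2)]
      by (intro convolution_has_real_derivative[OF g W(1) _ K(1,2)] smooth) auto
  qed
  \<comment> \<open>The parameters for which the moved point stays in \<open>D\<close>, where the
    integral representations hold. They form a neighbourhood of 0, which is all that a derivative at
    0 sees.\<close>
  define S where "S b = (\<lambda>s::real. r + s *\<^sub>R b) -` D" for b
  have S: "open (S b)" "0 \<in> S b" for b
    unfolding S_def using D by (auto intro!: open_vimage continuous_intros)
  \<comment> \<open>One derivative is computed twice: under the integral sign, giving
    \<open>J b\<close>, and by the product rule. Differentiability of \<open>\<rho>\<close> along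
    \<open>b\<close> comes from its integral representation, and there is no division by
    \<open>\<rho>\<close>.\<close>
  have product: "J b = I b * (u r \<bullet> b) + \<rho> r * (frechet_derivative u (at r) b \<bullet> b)" for b
  proof -
    have 1: "((\<lambda>s. \<rho> (r + s *\<^sub>R b)) has_real_derivative I b) (at 0)"
      unfolding I_def
      by (rule has_field_derivative_transform_within_open[OF deriv[OF W(2)] S[of b]])
         (simp add: S_def \<rho>')
    have "((\<lambda>s. \<rho> (r + s *\<^sub>R b) * (u (r + s *\<^sub>R b) \<bullet> b)) has_real_derivative J b) (at 0)"
      unfolding J_def
      by (rule has_field_derivative_transform_within_open[OF deriv S[of b]])
         (auto simp: S_def \<rho>u' intro!: continuous_intros W)
    moreover have "((\<lambda>s. u (r + s *\<^sub>R b) \<bullet> b) has_real_derivative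
        frechet_derivative u (at r) b \<bullet> b) (at 0)"
    proof -
      have "((\<lambda>x. u x \<bullet> b) has_derivative (\<lambda>h. frechet_derivative u (at r) h \<bullet> b)) (at r)"
        using u by (auto intro!: derivative_eq_intros simp: frechet_derivative_works[symmetric])
      then have "frechet_derivative (\<lambda>x. u x \<bullet> b) (at r) = (\<lambda>h. frechet_derivative u (at r) h \<bullet> b)"
        "(\<lambda>x. u x \<bullet> b) differentiable at r"
        using frechet_derivative_at differentiable_def by (metis, blast)
      then show ?thesis
        using has_real_derivative_along_line[of "\<lambda>x. u x \<bullet> b" r 0 b UNIV] by simp
    qed
    from DERIV_mult[OF 1 this]
    have "((\<lambda>s. \<rho> (r + s *\<^sub>R b) * (u (r + s *\<^sub>R b) \<bullet> b)) has_real_derivative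
        I b * (u r \<bullet> b) + \<rho> r * (frechet_derivative u (at r) b \<bullet> b)) (at 0)"
      by (simp add: mult_ac)
    ultimately show ?thesis
      by (rule DERIV_unique)
  qed
  have grad_\<phi>: "a \<bullet> grad (\<lambda>x. \<phi> (x - y)) r = (\<Sum>b\<in>Basis. (a \<bullet> b) * d b (r - y))" for a y
  proof -
    have "(\<phi> has_derivative frechet_derivative \<phi> (at (r - y))) (at (r - y))"
      using smooth(1) frechet_derivative_works by blast
    then have "((\<lambda>x. \<phi> (x - y)) has_derivative frechet_derivative \<phi> (at (r - y))) (at r)"
      by (rule has_derivative_compose[where g = \<phi> and f = "\<lambda>x. x - y", rotated])
         (auto intro!: derivative_eq_intros)
    then show ?thesis
      using frechet_derivative_at by (fastforce simp: grad_def inner_sum_right d_def mult.commute)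
  qed
  define F where "F y = m y * ((u r - v y) \<bullet> grad (\<lambda>x. \<phi> (x - y)) r)" for y
  \<comment> \<open>Since \<open>u r\<close> is constant in \<open>y\<close>, the integrand splits
    into the kernels of \<open>I b\<close> and \<open>J b\<close>.\<close>
  have F: "F = (\<lambda>y. \<Sum>b\<in>Basis. (u r \<bullet> b) * (m y * d b (r - y)) - (m y * (v y \<bullet> b)) * d b (r - y))"
    by (rule ext) (simp add: F_def grad_\<phi> sum_distrib_left algebra_simps)
  have ints: "integrable lborel (\<lambda>y. m y * d b (r - y))"
    "integrable lborel (\<lambda>y. (m y * (v y \<bullet> b)) * d b (r - y))" for b
    by (rule int[OF D(2) _ cd]; auto intro!: continuous_intros W)+
  have Fint: "integrable lborel F"
    unfolding F using ints by (intro Bochner_Integration.integrable_sum Bochner_Integration.integrable_diff) auto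
  have Fout: "F y = 0" if "y \<notin> \<Omega>h r" for y
    using d_out[OF that] by (simp add: F)
  have "set_integrable lborel (\<Omega>h r) F"
    using Fint Fout by (simp add: set_lebesgue_integral_eq_support)
  then show "set_integrable lborel (\<Omega>h r) (\<lambda>y. m y * ((u r - v y) \<bullet> grad (\<lambda>x. \<phi> (x - y)) r))"
    by (simp only: F_def[abs_def])
  have "(LINT y:\<Omega>h r|lborel. F y) = integral\<^sup>L lborel F"
    using Fout by (simp add: set_lebesgue_integral_eq_support)
  also have "\<dots> = (\<Sum>b\<in>Basis. (u r \<bullet> b) * I b - J b)"
    unfolding F I_def J_def using ints
    by (subst Bochner_Integration.integral_sum) (auto intro!: sum.cong)
  \<comment> \<open>By \<open>product\<close> the terms \<open>(u r \<bullet> b) * I b\<close>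
    cancel, leaving minus \<rho> times the diagonal entries of the derivative of \<open>u\<close>,
    whose sum is the divergence.\<close>
  also have "\<dots> = - (\<rho> r * divergence u r)"
    by (simp add: product divergence_def sum_distrib_left mult.commute flip: sum_negf)
  finally show "\<rho> r * divergence u r
      = - (LINT y:\<Omega>h r|lborel. m y * ((u r - v y) \<bullet> grad (\<lambda>x. \<phi> (x - y)) r))"
    by (simp add: F_def)
qed

section \<open>Passage from a fixed time to the time-dependent fields\<close>

theorem corollary3p1:
  fixes T :: "real set"
    and \<Omega> \<Omega>\<^sub>F \<Omega>\<^sub>D :: "'v::euclidean_space set"
    and \<Omega>h :: "'v \<Rightarrow> 'v set"
    and \<rho> p \<rho>h ph :: "real \<Rightarrow> 'v \<Rightarrow> real"
    and u uh :: "real \<Rightarrow> 'v \<Rightarrow> 'v"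
    and w \<phi> :: "'v \<Rightarrow> real"
  assumes regions: "open T" "open \<Omega>" "open \<Omega>\<^sub>F" "open \<Omega>\<^sub>D" "\<Omega>\<^sub>D \<subseteq> \<Omega>\<^sub>F" "\<Omega>\<^sub>F \<subseteq> \<Omega>"
    and test_space: "\<And>r. r \<in> \<Omega>\<^sub>F \<Longrightarrow> locally compact (\<Omega>h r) \<and> r \<in> \<Omega>h r \<and> \<Omega>h r \<subseteq> \<Omega>"
    and test_space_D: "\<And>r. r \<in> \<Omega>\<^sub>D \<Longrightarrow> \<Omega>h r \<subseteq> \<Omega>\<^sub>F"
    and density: "(\<lambda>(t, r). \<rho> t r) differentiable_on (T \<times> \<Omega>)"
    and velocity: "\<And>t. t \<in> T \<Longrightarrow> u t differentiable_on \<Omega>"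
    and pressure: "\<And>t. t \<in> T \<Longrightarrow> continuous_on \<Omega> (p t)"
    and w: "filter_on \<Omega>\<^sub>F \<Omega>h w"
    and FIT: "FIT T \<Omega>\<^sub>F \<Omega>h w \<rho> u p \<rho>h uh ph"
    and filtered_density: "(\<lambda>(t, r). \<rho>h t r) differentiable_on (T \<times> \<Omega>\<^sub>F)"
    and filtered_velocity: "\<And>t. t \<in> T \<Longrightarrow> uh t differentiable_on \<Omega>\<^sub>F"
    and filtered_continuity: "\<And>t r. t \<in> T \<Longrightarrow> r \<in> \<Omega>\<^sub>F \<Longrightarrow>
          material_deriv uh \<rho>h t r = - \<rho>h t r * divergence (uh t) r"
    and \<phi>: "filter_on \<Omega>\<^sub>D \<Omega>h \<phi>"
    and DIT: "DIT T \<Omega>\<^sub>D \<Omega>h \<phi> \<rho> u p \<rho>h uh ph"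
  shows "\<forall>t\<in>T. \<forall>r\<in>\<Omega>\<^sub>D.
     (material_deriv u \<rho> t r
          = (LINT r':\<Omega>h r|lborel. \<rho>h t r' * ((u t r - uh t r') \<bullet> grad (\<lambda>x. \<phi> (x - r')) r))
        \<longleftrightarrow> material_deriv u \<rho> t r = - \<rho> t r * divergence (u t) r) \<and>
     set_integrable lborel (\<Omega>h r)
       (\<lambda>r'. \<rho>h t r' * ((u t r - uh t r') \<bullet> grad (\<lambda>x. \<phi> (x - r')) r)) \<and>
     \<rho> t r * divergence (u t) r
       = - (LINT r':\<Omega>h r|lborel. \<rho>h t r' * ((u t r - uh t r') \<bullet> grad (\<lambda>x. \<phi> (x - r')) r))"
proof (intro ballI)
  fix t r assume t: "t \<in> T" and r: "r \<in> \<Omega>\<^sub>D"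
  have "r \<in> \<Omega>"
    using regions r by blast
  \<comment> \<open>Openness of \<Omega> turns differentiability within the region into
    differentiability at the point.\<close>
  then have "u t differentiable at r"
    using velocity[OF t] regions(2) by (metis at_within_open differentiable_on_def)
  moreover have "continuous_on \<Omega>\<^sub>F (\<rho>h t)"
  proof -
    have "continuous_on (T \<times> \<Omega>\<^sub>F) (\<lambda>(t, r). \<rho>h t r)"
      by (rule differentiable_imp_continuous_on[OF filtered_density])
    from continuous_on_compose2[OF this, of \<Omega>\<^sub>F "\<lambda>x. (t, x)"] show ?thesis
      using t by (simp add: continuous_intros image_subset_iff)
  qed
  moreover have "continuous_on \<Omega>\<^sub>F (uh t)"
    by (rule differentiable_imp_continuous_on[OF filtered_velocity[OF t]])
  moreover have "\<rho> t x = (LINT y:\<Omega>h x|lborel. \<rho>h t y * \<phi> (x - y))"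
    "\<rho> t x *\<^sub>R u t x = (LINT y:\<Omega>h x|lborel. (\<rho>h t y * \<phi> (x - y)) *\<^sub>R uh t y)" if "x \<in> \<Omega>\<^sub>D" for x
    using DIT[unfolded DIT_def, rule_format, OF t that] by blast+
  \<comment> \<open>The fixed-time identity is applied with \<open>D\<close> as
    \<open>\<Omega>\<^sub>D\<close> and \<open>W\<close> as \<open>\<Omega>\<^sub>F\<close>: test
    spaces of points of the former lie in the latter, where the filtered fields are
    continuous.\<close>
  ultimately have
    "set_integrable lborel (\<Omega>h r)
       (\<lambda>r'. \<rho>h t r' * ((u t r - uh t r') \<bullet> grad (\<lambda>x. \<phi> (x - r')) r))"
    "\<rho> t r * divergence (u t) r
       = - (LINT r':\<Omega>h r|lborel. \<rho>h t r' * ((u t r - uh t r') \<bullet> grad (\<lambda>x. \<phi> (x - r')) r))"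
    using defiltered_divergence[OF regions(4) r regions(3) _ _ test_space_D \<phi>, of "\<rho>h t" "uh t" "\<rho> t" "u t"]
    by blast+
  then show "(material_deriv u \<rho> t r
          = (LINT r':\<Omega>h r|lborel. \<rho>h t r' * ((u t r - uh t r') \<bullet> grad (\<lambda>x. \<phi> (x - r')) r))
        \<longleftrightarrow> material_deriv u \<rho> t r = - \<rho> t r * divergence (u t) r) \<and>
     set_integrable lborel (\<Omega>h r)
       (\<lambda>r'. \<rho>h t r' * ((u t r - uh t r') \<bullet> grad (\<lambda>x. \<phi> (x - r')) r)) \<and>
     \<rho> t r * divergence (u t) r
       = - (LINT r':\<Omega>h r|lborel. \<rho>h t r' * ((u t r - uh t r') \<bullet> grad (\<lambda>x. \<phi> (x - r')) r))"
    \<comment> \<open>The divergence identity makes the right-hand sides of the two continuity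
      equations equal, which gives the equivalence.\<close>
    by simp
qed

end
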